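(* Let $s, r, k, n_1, n_2, n_3$ be positive integers with $2\leq s\leq r$, $n_1\leq n_2\leq n_3$ and $k\leq n_1$, and put $n_i=n_3$ for all $i$ with $4\leq i\leq r$. Then $$ex\left(K_{n_1,n_2,\underbrace{n_3,\ldots,n_3}_{r-2}},\, K_s,\, kK_r\right)=\sum_{\substack{A\subset\{1,\ldots,r\}\\ |A|=s,\ \{1,2\}\not\subset A}}\ \prod_{i\in A}n_i\;+\;\sum_{\substack{A\subset\{3,\ldots,r\}\\ |A|=s-2}}(k-1)\,n_2\prod_{i\in A}n_i.$$
   Context: For graphs $G,T,F$, $ex(G,T,F)$ denotes the maximum number of copies of $T$ in an $F$-free subgraph of $G$, where a graph is $F$-free if it contains no copy of $F$ as a (not necessarily induced) subgraph. $K_t$ is the complete graph on $t$ vertices (so copies of $K_s$ in a graph are its $s$-cliques, i.e. $s$-element vertex sets that are pairwise adjacent), and $kK_r$ is the graph consisting of $k$ vertex-disjoint copies of $K_r$. $K_{n_1,\ldots,n_r}$ denotes the complete $r$-partite graph with vertex classes of sizes $n_1,\ldots,n_r$. An empty product equals $1$ (so for $s=2$ the second sum has the single term $(k-1)n_2$, coming from $A=\emptyset$). *)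

theory Defs
  imports Main
begin

text \<open>A graph is a pair of a vertex set and a set of edges, each edge being a two-element set
  of vertices.\<close>

type_synonym 'a graph = "'a set \<times> 'a set set"

abbreviation verts :: "'a graph \<Rightarrow> 'a set" where
  "verts \<equiv> fst"

abbreviation edges :: "'a graph \<Rightarrow> 'a set set" where
  "edges \<equiv> snd"

definition simple_graph :: "'a graph \<Rightarrow> bool" where
  "simple_graph G \<longleftrightarrow> finite (verts G) \<and> (\<forall>e \<in> edges G. e \<subseteq> verts G \<and> card e = 2)"

definition subgraph :: "'a graph \<Rightarrow> 'a graph \<Rightarrow> bool" where
  "subgraph H G \<longleftrightarrow> simple_graph H \<and> verts H \<subseteq> verts G \<and> edges H \<subseteq> edges G"

definition graph_iso :: "'a graph \<Rightarrow> 'b graph \<Rightarrow> bool" where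
  "graph_iso G H \<longleftrightarrow> (\<exists>f. bij_betw f (verts G) (verts H) \<and>
     (\<forall>u \<in> verts G. \<forall>v \<in> verts G. {u, v} \<in> edges G \<longleftrightarrow> {f u, f v} \<in> edges H))"

text \<open>Copies are unlabelled: a copy of T in G is a subgraph of G isomorphic to T, so
  automorphisms of T do not contribute to the count.\<close>

definition copies :: "'b graph \<Rightarrow> 'a graph \<Rightarrow> 'a graph set" where
  "copies T G = {H. subgraph H G \<and> graph_iso H T}"

definition graph_free :: "'b graph \<Rightarrow> 'a graph \<Rightarrow> bool" where
  "graph_free F G \<longleftrightarrow> copies F G = {}"

text \<open>If the vertex set of G is finite and F has a vertex, the maximum is over a finite set
  that is nonempty (the empty subgraph is F-free).\<close>

definition ex_copies :: "'a graph \<Rightarrow> 'b graph \<Rightarrow> 'c graph \<Rightarrow> nat" where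
  "ex_copies G T F = Max {card (copies T H) | H. subgraph H G \<and> graph_free F H}"

definition complete_graph :: "nat \<Rightarrow> nat graph" where
  "complete_graph t = ({..<t}, {e. e \<subseteq> {..<t} \<and> card e = 2})"

definition disjoint_copies :: "nat \<Rightarrow> 'a graph \<Rightarrow> (nat \<times> 'a) graph" where
  "disjoint_copies k G =
     ({..<k} \<times> verts G, {Pair i ` e | i e. i < k \<and> e \<in> edges G})"

text \<open>The vertex classes are indexed by 1, ..., r; the i-th one is {i} \<times> {0, ..., n i - 1}.\<close>

definition complete_multipartite :: "nat \<Rightarrow> (nat \<Rightarrow> nat) \<Rightarrow> (nat \<times> nat) graph" where
  "complete_multipartite r n =
     (let V = (SIGMA i:{1..r}. {..<n i})
      in (V, {{u, v} | u v. u \<in> V \<and> v \<in> V \<and> fst u \<noteq> fst v}))"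

end

theory Submission
  imports Defs "HOL-Library.FuncSet" "HOL-Library.Disjoint_Sets" "HOL-Combinatorics.Transposition"
begin

text \<open>Write \<open>V\<^sub>1, \<dots>, V\<^sub>r\<close> for the vertex classes. A clique of a subgraph \<open>H\<close> of the complete
  multipartite graph meets each class at most once, so an \<open>s\<close>-clique is the same thing as a set
  \<open>A\<close> of \<open>s\<close> classes with a choice \<open>q\<close> of one vertex in each, all pairs of which are edges of
  \<open>H\<close>. A copy of \<open>k K\<^sub>r\<close> is a family of \<open>k\<close> disjoint transversals (choices over all
  classes), each of which is a clique.

  The extremal graph keeps, between \<open>V\<^sub>1\<close> and \<open>V\<^sub>2\<close>, only the edges at \<open>k - 1\<close> fixed vertices
  of \<open>V\<^sub>1\<close>. Every \<open>r\<close>-clique then uses one of these \<open>k - 1\<close> vertices, so no \<open>k\<close> of them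
  are disjoint, and counting its \<open>s\<close>-cliques gives the two sums of the theorem.

  For the upper bound, read each \<open>V\<^sub>i\<close> as the integers modulo \<open>n i\<close>. Since \<open>n 1\<close> is the least
  of the class sizes, the translates of a transversal by \<open>0, \<dots>, n 1 - 1\<close> are pairwise
  disjoint, so at most \<open>k - 1\<close> of them are cliques of \<open>H\<close>. Averaging over all transversals, at
  least the fraction \<open>(n 1 - (k - 1)) / n 1\<close> of them are bad, that is, not cliques of \<open>H\<close>
  (\<open>card_joined_transversals_le\<close>).

  It remains to turn bad transversals into missing \<open>s\<close>-cliques. Count the pairs of a bad
  transversal \<open>f\<close> and an index set \<open>A\<close> over which \<open>f\<close> is not a clique, giving a pair the weight
  \<open>P\<^sub>A = (\<Prod>i\<in>A. n i)\<close>. With this weight every missing \<open>s\<close>-clique contributes the same amount: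
  one over \<open>A\<close> extends to \<open>P / P\<^sub>A\<close> transversals, where \<open>P\<close> is the number of all transversals,
  and thus contributes \<open>P\<close>. On the other hand a bad transversal lacks an edge between some
  classes \<open>i\<close> and \<open>j\<close>, hence its total weight is at least the sum of \<open>P\<^sub>A\<close> over all
  \<open>A \<supseteq> {i, j}\<close>. That sum is least for \<open>{i, j} = {1, 2}\<close> (\<open>sum_prod_pair_minimal\<close>), where it is
  \<open>n 1\<close> times \<open>e = (\<Sum>B. n 2 * P\<^sub>B)\<close>, with \<open>B\<close> ranging over the \<open>(s - 2)\<close>-subsets of
  \<open>{3..r}\<close>. So at least \<open>(n 1 - (k - 1)) * e\<close> cliques of the complete multipartite graph are
  missing from \<open>H\<close>, which is exactly the number missing from the extremal graph.\<close>

definition clique_sets :: "nat \<Rightarrow> 'a graph \<Rightarrow> 'a set set" where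
  "clique_sets s G = {W. W \<subseteq> verts G \<and> card W = s \<and>
     (\<forall>u \<in> W. \<forall>v \<in> W. u \<noteq> v \<longrightarrow> {u, v} \<in> edges G)}"

text \<open>The choices of one vertex in each class of \<open>A\<close>; the second coordinate alone is recorded, and
  being extensional makes a choice determined by its values on \<open>A\<close>.\<close>

definition sections :: "nat set \<Rightarrow> (nat \<Rightarrow> nat) \<Rightarrow> (nat \<Rightarrow> nat) set" where
  "sections A n = (\<Pi>\<^sub>E i\<in>A. {..<n i})"

definition points :: "nat set \<Rightarrow> (nat \<Rightarrow> nat) \<Rightarrow> (nat \<times> nat) set" where
  "points A q = (\<lambda>i. (i, q i)) ` A"

definition joined :: "(nat \<times> nat) graph \<Rightarrow> nat set \<Rightarrow> (nat \<Rightarrow> nat) \<Rightarrow> bool" where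
  "joined G A q \<longleftrightarrow> (\<forall>i \<in> A. \<forall>j \<in> A. i \<noteq> j \<longrightarrow> {(i, q i), (j, q j)} \<in> edges G)"

lemma finite_sections: "finite A \<Longrightarrow> finite (sections A n)"
  by (auto simp: sections_def intro: finite_PiE)

lemma card_sections: "finite A \<Longrightarrow> card (sections A n) = (\<Prod>i\<in>A. n i)"
  by (simp add: sections_def card_PiE)

lemma joined_cong: "(\<And>i. i \<in> A \<Longrightarrow> q i = q' i) \<Longrightarrow> joined G A q = joined G A q'"
  by (simp add: joined_def)

section \<open>Copies of complete graphs as sets of vertices\<close>

lemma simple_graph_edge:
  assumes "simple_graph G" "{u, v} \<in> edges G"
  shows "u \<in> verts G"
  using assms by (auto simp: simple_graph_def)

lemma edges_complete_graph:
  "{u, v} \<in> edges (complete_graph t) \<longleftrightarrow> u < t \<and> v < t \<and> u \<noteq> v"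
  by (auto simp: complete_graph_def card_insert_if)

text \<open>A copy of a complete graph is determined by its vertices, so copies can be counted as vertex
  sets.\<close>

lemma copy_of_complete_graph:
  assumes H: "H \<in> copies (complete_graph s) G"
  shows "verts H \<in> clique_sets s G" "edges H = {e. e \<subseteq> verts H \<and> card e = 2}"
proof -
  have sg: "simple_graph H" and sub: "verts H \<subseteq> verts G" "edges H \<subseteq> edges G"
    and iso: "graph_iso H (complete_graph s)"
    using H by (auto simp: copies_def subgraph_def)
  obtain f where f: "bij_betw f (verts H) {..<s}"
    and e: "\<And>u v. u \<in> verts H \<Longrightarrow> v \<in> verts H \<Longrightarrow>
              {u, v} \<in> edges H \<longleftrightarrow> {f u, f v} \<in> edges (complete_graph s)"
    using iso unfolding graph_iso_def by (auto simp: complete_graph_def)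
  have inj: "inj_on f (verts H)" and img: "\<And>u. u \<in> verts H \<Longrightarrow> f u < s"
    using f by (auto simp: bij_betw_def)
  have all: "{u, v} \<in> edges H" if "u \<in> verts H" "v \<in> verts H" "u \<noteq> v" for u v
    using that e[OF that(1,2)] img inj by (auto simp: edges_complete_graph inj_on_def)
  show "verts H \<in> clique_sets s G"
    using sub all bij_betw_same_card[OF f] by (auto simp: clique_sets_def)
  show "edges H = {e. e \<subseteq> verts H \<and> card e = 2}"
    using sg all by (auto simp: simple_graph_def card_2_iff)
qed

lemma card_copies_complete_graph:
  assumes G: "simple_graph G"
  shows "card (copies (complete_graph s) G) = card (clique_sets s G)"
proof (rule bij_betw_same_card[of verts], unfold bij_betw_def, intro conjI)
  show "inj_on verts (copies (complete_graph s) G)"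
    by (intro inj_onI prod_eqI) (auto simp: copy_of_complete_graph(2))
  have "W \<in> verts ` copies (complete_graph s) G" if W: "W \<in> clique_sets s G" for W
  proof
    let ?H = "(W, {e. e \<subseteq> W \<and> card e = 2})"
    have sub: "W \<subseteq> verts G" and card: "card W = s"
      and all: "\<And>u v. u \<in> W \<Longrightarrow> v \<in> W \<Longrightarrow> u \<noteq> v \<Longrightarrow> {u, v} \<in> edges G"
      using W by (auto simp: clique_sets_def)
    have fin: "finite W"
      using G sub by (auto simp: simple_graph_def intro: finite_subset)
    obtain f where f: "bij_betw f W {..<s}"
      using ex_bij_betw_finite_nat[OF fin] card by (auto simp: lessThan_atLeast0)
    have "graph_iso ?H (complete_graph s)"
      unfolding graph_iso_def
    proof (intro exI[of _ f] conjI ballI)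
      show "bij_betw f (verts ?H) (verts (complete_graph s))"
        using f by (simp add: complete_graph_def)
      fix u v assume "u \<in> verts ?H" "v \<in> verts ?H"
      then show "{u, v} \<in> edges ?H \<longleftrightarrow> {f u, f v} \<in> edges (complete_graph s)"
        using f by (auto simp: edges_complete_graph bij_betw_def inj_on_def card_insert_if)
    qed
    moreover have "subgraph ?H G"
      using fin sub all by (auto simp: subgraph_def simple_graph_def card_2_iff)
    ultimately show "?H \<in> copies (complete_graph s) G"
      by (simp add: copies_def)
  qed simp
  then show "verts ` copies (complete_graph s) G = clique_sets s G"
    using copy_of_complete_graph(1) by blast
qed

lemma edges_disjoint_copies:
  "{(i, u), (j, v)} \<in> edges (disjoint_copies k G) \<longleftrightarrow> i < k \<and> i = j \<and> {u, v} \<in> edges G"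
  (is "?L \<longleftrightarrow> ?R")
proof
  assume ?L
  then obtain m e where m: "{(i, u), (j, v)} = Pair m ` e" "m < k" "e \<in> edges G"
    by (auto simp: disjoint_copies_def)
  have "i = m" "j = m" using m(1) by auto
  moreover have "snd ` {(i, u), (j, v)} = snd ` Pair m ` e" by (simp only: m(1))
  then have "e = {u, v}" by (simp add: image_image)
  ultimately show ?R using m by auto
next
  assume ?R
  then have "{(i, u), (j, v)} = Pair i ` {u, v} \<and> i < k \<and> {u, v} \<in> edges G" by auto
  then show ?L unfolding disjoint_copies_def snd_conv by blast
qed

text \<open>A copy yields the cliques
  that are the images of its \<open>k\<close> components, and disjoint cliques yield a copy by enumerating
  each of them with \<open>{..<r}\<close>.\<close>

lemma not_free_iff_disjoint_cliques:
  assumes G: "simple_graph G"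
  shows "\<not> graph_free (disjoint_copies k (complete_graph r)) G \<longleftrightarrow>
    (\<exists>W. (\<forall>i<k. W i \<in> clique_sets r G) \<and> disjoint_family_on W {..<k})"
    (is "?L \<longleftrightarrow> ?R")
proof
  let ?F = "disjoint_copies k (complete_graph r)"
  have vF: "verts ?F = {..<k} \<times> {..<r}"
    by (simp add: disjoint_copies_def complete_graph_def)
  {
    assume ?L
    then obtain H where H: "subgraph H G" and iso: "graph_iso H ?F"
      by (auto simp: graph_free_def copies_def)
    obtain f where f: "bij_betw f (verts H) (verts ?F)"
      and e: "\<And>u v. u \<in> verts H \<Longrightarrow> v \<in> verts H \<Longrightarrow> {u, v} \<in> edges H \<longleftrightarrow> {f u, f v} \<in> edges ?F"
      using iso unfolding graph_iso_def by auto
    define g where "g = the_inv_into (verts H) f"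
    have g: "bij_betw g (verts ?F) (verts H)"
      unfolding g_def by (rule bij_betw_the_inv_into[OF f])
    have fg: "f (g x) = x" if "x \<in> verts ?F" for x
      unfolding g_def using f that by (auto simp: bij_betw_def intro: f_the_inv_into_f)
    have inj: "inj_on g ({..<k} \<times> {..<r})" and gH: "\<And>x. x \<in> {..<k} \<times> {..<r} \<Longrightarrow> g x \<in> verts H"
      using g vF by (auto simp: bij_betw_def)
    define W where "W i = (\<lambda>u. g (i, u)) ` {..<r}" for i
    have "W i \<in> clique_sets r G" if "i < k" for i
      unfolding clique_sets_def mem_Collect_eq
    proof (intro conjI ballI impI)
      show "W i \<subseteq> verts G"
        using gH that H by (auto simp: W_def subgraph_def)
      have "inj_on (\<lambda>u. g (i, u)) {..<r}"
        using inj that by (auto simp: inj_on_def)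
      then show "card (W i) = r"
        by (simp add: W_def card_image)
      fix u v assume "u \<in> W i" "v \<in> W i" "u \<noteq> v"
      then obtain a b where ab: "u = g (i, a)" "v = g (i, b)" "a < r" "b < r" "a \<noteq> b"
        by (auto simp: W_def)
      then have "{f u, f v} \<in> edges ?F"
        using that by (simp add: fg vF edges_disjoint_copies edges_complete_graph)
      then show "{u, v} \<in> edges G"
        using e[of u v] gH ab that H by (auto simp: subgraph_def)
    qed
    moreover have "disjoint_family_on W {..<k}"
      unfolding disjoint_family_on_def
    proof (intro ballI impI equals0I)
      fix i j x assume "i \<in> {..<k}" "j \<in> {..<k}" "i \<noteq> j" "x \<in> W i \<inter> W j"
      then obtain a b where "g (i, a) = g (j, b)" "a < r" "b < r"
        by (auto simp: W_def)
      then show False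
        using inj_onD[OF inj, of "(i, a)" "(j, b)"] \<open>i \<in> _\<close> \<open>j \<in> _\<close> \<open>i \<noteq> j\<close> by auto
    qed
    ultimately show ?R by blast
  }
  {
    assume ?R
    then obtain W where W: "\<And>i. i < k \<Longrightarrow> W i \<in> clique_sets r G"
      and dis: "disjoint_family_on W {..<k}" by blast
    have fin: "finite (W i)" and cardW: "card (W i) = r" if "i < k" for i
      using W[OF that] G by (auto simp: clique_sets_def simple_graph_def intro: finite_subset)
    have "\<exists>h. bij_betw h {..<r} (W i)" if "i < k" for i
      using ex_bij_betw_nat_finite[OF fin[OF that]] cardW[OF that] by (simp add: lessThan_atLeast0)
    then obtain h where h: "\<And>i. i < k \<Longrightarrow> bij_betw (h i) {..<r} (W i)" by metis
    define g where "g = (\<lambda>(i, u). h i u)"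
    have hW: "h i u \<in> W i" if "i < k" "u < r" for i u
      using h[OF that(1)] that(2) by (auto simp: bij_betw_def)
    have inj: "inj_on g ({..<k} \<times> {..<r})"
    proof (intro inj_onI, clarify)
      fix i u j v assume a: "i < k" "u < r" "j < k" "v < r" "g (i, u) = g (j, v)"
      then have eq: "h i u = h j v" by (simp add: g_def)
      then have "h i u \<in> W i \<inter> W j"
        using hW a by (metis IntI)
      then have ij: "i = j"
        using dis a by (auto simp: disjoint_family_on_def)
      then show "i = j \<and> u = v"
        using h[OF a(1)] a eq by (auto simp: bij_betw_def inj_on_def)
    qed
    define H where "H = (g ` verts ?F, (`) g ` edges ?F)"
    have eF: "\<exists>i u v. e = {(i, u), (i, v)} \<and> i < k \<and> u < r \<and> v < r \<and> u \<noteq> v" if e: "e \<in> edges ?F" for e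
    proof -
      obtain i e' where i: "e = Pair i ` e'" "i < k" "e' \<subseteq> {..<r}" "card e' = 2"
        using e unfolding disjoint_copies_def complete_graph_def fst_conv snd_conv by blast
      then obtain u v where "e' = {u, v}" "u \<noteq> v" by (auto simp: card_2_iff)
      then show ?thesis using i by auto
    qed
    have sub: "subgraph H G"
      unfolding subgraph_def simple_graph_def
    proof (intro conjI ballI)
      show "finite (verts H)" by (simp add: H_def vF)
      show "verts H \<subseteq> verts G"
        using hW W by (fastforce simp: H_def vF g_def clique_sets_def)
      show "edges H \<subseteq> edges G"
      proof
        fix e assume "e \<in> edges H"
        then obtain e' where e': "e = g ` e'" "e' \<in> edges ?F" by (auto simp: H_def)
        then obtain i u v where iuv: "e' = {(i, u), (i, v)}" "i < k" "u < r" "v < r" "u \<noteq> v"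
          using eF by blast
        have "h i u \<noteq> h i v"
          using h[OF iuv(2)] iuv by (auto simp: bij_betw_def inj_on_def)
        then show "e \<in> edges G"
          using W[OF iuv(2)] hW[of i u] hW[of i v] iuv e'
          by (auto simp: clique_sets_def g_def)
      qed
      then show "card e = 2" if "e \<in> edges H" for e
        using G that by (auto simp: simple_graph_def)
      show "e \<subseteq> verts H" if e: "e \<in> edges H" for e
      proof -
        obtain e' where e': "e = g ` e'" "e' \<in> edges ?F" using e by (auto simp: H_def)
        have "e' \<subseteq> verts ?F" using eF[OF e'(2)] by (auto simp: vF)
        then show ?thesis using e' by (auto simp: H_def)
      qed
    qed
    have bij: "bij_betw g (verts ?F) (verts H)"
      using inj by (simp add: bij_betw_def H_def vF)
    define f where "f = the_inv_into (verts ?F) g"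
    have "graph_iso H ?F"
      unfolding graph_iso_def
    proof (intro exI[of _ f] conjI ballI)
      show "bij_betw f (verts H) (verts ?F)"
        unfolding f_def by (rule bij_betw_the_inv_into[OF bij])
      fix u v assume "u \<in> verts H" "v \<in> verts H"
      then obtain x y where xy: "u = g x" "v = g y" "x \<in> verts ?F" "y \<in> verts ?F"
        by (auto simp: H_def)
      have fx: "f u = x" "f v = y"
        using xy inj by (auto simp: f_def vF the_inv_into_f_f)
      have "{x, y} \<in> edges ?F" if uv: "{u, v} \<in> edges H"
      proof -
        obtain e where e: "{u, v} = g ` e" "e \<in> edges ?F" using uv by (auto simp: H_def)
        have "e \<subseteq> verts ?F" using eF[OF e(2)] by (auto simp: vF)
        moreover have "g ` {x, y} = g ` e" using e xy by simp
        ultimately have "{x, y} = e"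
          using inj_on_image_eq_iff[OF inj, of "{x, y}" e] xy vF by simp
        then show ?thesis using e by simp
      qed
      moreover have "{u, v} \<in> edges H" if "{x, y} \<in> edges ?F"
      proof -
        have "g ` {x, y} \<in> edges H" unfolding H_def snd_conv by (rule imageI) (rule that)
        then show ?thesis using xy by simp
      qed
      ultimately show "{u, v} \<in> edges H \<longleftrightarrow> {f u, f v} \<in> edges ?F"
        using fx by auto
    qed
    with sub have "H \<in> copies ?F G" by (simp add: copies_def)
    then show ?L by (auto simp: graph_free_def)
  }
qed

section \<open>Cliques of a multipartite graph as partial transversals\<close>

lemma simple_complete_multipartite: "simple_graph (complete_multipartite r n)"
  by (auto simp: simple_graph_def complete_multipartite_def Let_def card_insert_if)

lemma verts_complete_multipartite:
  "verts (complete_multipartite r n) = (SIGMA i:{1..r}. {..<n i})"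
  by (simp add: complete_multipartite_def Let_def)

lemma edges_complete_multipartite:
  "{u, v} \<in> edges (complete_multipartite r n) \<longleftrightarrow>
     u \<in> (SIGMA i:{1..r}. {..<n i}) \<and> v \<in> (SIGMA i:{1..r}. {..<n i}) \<and> fst u \<noteq> fst v"
  (is "?L \<longleftrightarrow> ?R")
proof
  show "?L \<Longrightarrow> ?R"
    unfolding complete_multipartite_def Let_def by (auto simp: doubleton_eq_iff)
  show "?R \<Longrightarrow> ?L"
    unfolding complete_multipartite_def Let_def snd_conv by blast
qed

lemma points_inj:
  assumes "q \<in> sections A n" "q' \<in> sections A' n" "points A q = points A' q'"
  shows "A = A'" "q = q'"
proof -
  have "fst ` points A q = fst ` points A' q'" by (simp only: assms)
  then show A: "A = A'" by (simp add: points_def image_image)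
  have "q i = q' i" if "i \<in> A" for i
  proof -
    have "(i, q i) \<in> points A' q'" using that assms(3) by (auto simp: points_def)
    then show ?thesis by (auto simp: points_def)
  qed
  then show "q = q'"
    using assms A unfolding sections_def by (metis PiE_ext)
qed

text \<open>With at least two classes every chosen vertex lies on an edge, so a choice whose pairs are all
  edges automatically consists of vertices of \<open>H\<close>.\<close>

lemma points_in_clique_sets_iff:
  assumes H: "simple_graph H" and "2 \<le> card A"
  shows "points A q \<in> clique_sets (card A) H \<longleftrightarrow> joined H A q"
proof
  assume "points A q \<in> clique_sets (card A) H"
  then show "joined H A q"
    unfolding joined_def clique_sets_def points_def by auto
next
  assume j: "joined H A q"
  have "(i, q i) \<in> verts H" if "i \<in> A" for i
  proof -
    have "\<not> A \<subseteq> {i}"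
      using \<open>2 \<le> card A\<close> card_mono[of "{i}" A] by auto
    then obtain j where "j \<in> A" "j \<noteq> i" by auto
    then show ?thesis
      using j that simple_graph_edge[OF H] by (metis joined_def)
  qed
  moreover have "card (points A q) = card A"
    unfolding points_def by (intro card_image inj_onI) auto
  ultimately show "points A q \<in> clique_sets (card A) H"
    using j by (auto simp: clique_sets_def joined_def points_def)
qed

lemma clique_is_points:
  assumes H: "subgraph H (complete_multipartite r n)" and W: "W \<in> clique_sets s H"
  obtains A q where "A \<subseteq> {1..r}" "card A = s" "q \<in> sections A n" "W = points A q"
proof -
  let ?V = "SIGMA i:{1..r}. {..<n i}"
  have WV: "W \<subseteq> ?V"
    using H W by (auto simp: subgraph_def clique_sets_def verts_complete_multipartite)
  have inj: "inj_on fst W"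
  proof (intro inj_onI, rule ccontr)
    fix u v assume "u \<in> W" "v \<in> W" "fst u = fst v" "u \<noteq> v"
    then have "{u, v} \<in> edges (complete_multipartite r n)"
      using H W by (auto simp: subgraph_def clique_sets_def)
    then show False
      using \<open>fst u = fst v\<close> by (simp add: edges_complete_multipartite)
  qed
  define A where "A = fst ` W"
  define q where "q = restrict (\<lambda>i. snd (the_inv_into W fst i)) A"
  have q: "q (fst u) = snd u" if "u \<in> W" for u
    using that inj by (simp add: q_def A_def the_inv_into_f_f)
  have "A \<subseteq> {1..r}" using WV by (auto simp: A_def)
  moreover have "card A = s"
    using W inj by (simp add: A_def card_image clique_sets_def)
  moreover have "q \<in> sections A n"
    unfolding sections_def
  proof (rule PiE_I)
    show "q i \<in> {..<n i}" if "i \<in> A" for i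
      using that q WV by (fastforce simp: A_def)
    show "q i = undefined" if "i \<notin> A" for i
      using that by (simp add: q_def)
  qed
  moreover have "W = points A q"
    using q by (force simp: points_def A_def image_image)
  ultimately show thesis by (rule that)
qed

text \<open>Two vertices of one class are never adjacent, so sorting the cliques by the classes they meet
  loses none of them.\<close>

lemma card_clique_sets:
  assumes H: "subgraph H (complete_multipartite r n)" and "2 \<le> s"
  shows "card (clique_sets s H) =
    (\<Sum>A | A \<subseteq> {1..r} \<and> card A = s. card {q \<in> sections A n. joined H A q})"
proof -
  let ?I = "{A. A \<subseteq> {1..r} \<and> card A = s}"
  let ?J = "\<lambda>A. {q \<in> sections A n. joined H A q}"
  have sH: "simple_graph H" using H by (simp add: subgraph_def)
  have finA: "finite A" if "A \<in> ?I" for A using that by (auto intro: finite_subset)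
  have "bij_betw (\<lambda>(A, q). points A q) (Sigma ?I ?J) (clique_sets s H)"
    unfolding bij_betw_def
  proof (intro conjI subset_antisym subsetI)
    show "inj_on (\<lambda>(A, q). points A q) (Sigma ?I ?J)"
      by (intro inj_onI) (auto dest: points_inj)
    show "W \<in> clique_sets s H" if "W \<in> (\<lambda>(A, q). points A q) ` Sigma ?I ?J" for W
      using that points_in_clique_sets_iff[OF sH] \<open>2 \<le> s\<close> by auto
    show "W \<in> (\<lambda>(A, q). points A q) ` Sigma ?I ?J" if W: "W \<in> clique_sets s H" for W
    proof -
      obtain A q where Aq: "A \<subseteq> {1..r}" "card A = s" "q \<in> sections A n" "W = points A q"
        using clique_is_points[OF H W] .
      then have "joined H A q"
        using points_in_clique_sets_iff[OF sH, of A q] W \<open>2 \<le> s\<close> by simp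
      then show ?thesis using Aq by force
    qed
  qed
  then have "card (clique_sets s H) = card (Sigma ?I ?J)"
    by (simp add: bij_betw_same_card)
  also have "\<dots> = (\<Sum>A\<in>?I. card (?J A))"
    using finA finite_sections by (intro card_SigmaI) auto
  finally show ?thesis .
qed

section \<open>Families of disjoint transversals\<close>

lemma add_mod_inj:
  fixes n :: nat
  assumes "x < n" "y < n" "(a + x) mod n = (a + y) mod n"
  shows "x = y"
proof -
  have le: "u \<le> v" if "u < n" "v < n" "(a + u) mod n = (a + v) mod n" for u v
  proof (rule ccontr)
    assume "\<not> u \<le> v"
    then have "n dvd u - v"
      using that(3) mod_eq_dvd_iff_nat[of "a + v" "a + u" n] by simp
    then show False
      using \<open>\<not> u \<le> v\<close> that(1) by (auto dest: dvd_imp_le)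
  qed
  show ?thesis using le[of x y] le[of y x] assms by simp
qed

text \<open>Translation by \<open>x\<close>, modulo the size of each class, permutes the transversals, while for fixed
  \<open>a\<close> the translates of \<open>a\<close> by \<open>x < m\<close> are pairwise disjoint. Counting the pairs \<open>(x, a)\<close>
  whose translate is a clique first by \<open>x\<close> and then by \<open>a\<close> gives the inequality.\<close>

lemma card_joined_transversals_le:
  assumes H: "subgraph H (complete_multipartite r n)"
    and free: "graph_free (disjoint_copies k (complete_graph r)) H"
    and "2 \<le> r" and m: "\<And>i. i \<in> {1..r} \<Longrightarrow> m \<le> n i"
  shows "m * card {q \<in> sections {1..r} n. joined H {1..r} q} \<le> (k - 1) * (\<Prod>i\<in>{1..r}. n i)"
proof -
  let ?I = "{1..r}"
  let ?S = "sections ?I n"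
  let ?good = "joined H ?I"
  define shift where "shift x a = restrict (\<lambda>i. (a i + x) mod n i) ?I" for x :: nat and a
  have sH: "simple_graph H" using H by (simp add: subgraph_def)
  have fin: "finite ?S" by (simp add: finite_sections)
  have shift_S: "shift x a \<in> ?S" if "a \<in> ?S" for x a
    unfolding sections_def
  proof (rule PiE_I)
    fix i assume i: "i \<in> ?I"
    then have "a i < n i" using that by (auto simp: sections_def)
    then show "shift x a i \<in> {..<n i}" using i by (simp add: shift_def)
  next
    show "shift x a i = undefined" if "i \<notin> ?I" for i
      using that by (simp only: shift_def restrict_apply if_False)
  qed
  have inj: "inj_on (shift x) ?S" for x
  proof (rule inj_onI)
    fix a b assume ab: "a \<in> ?S" "b \<in> ?S" "shift x a = shift x b"
    have "a i = b i" if "i \<in> ?I" for i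
    proof (rule add_mod_inj)
      show "a i < n i" "b i < n i" using ab that by (auto simp: sections_def)
      show "(x + a i) mod n i = (x + b i) mod n i"
        using fun_cong[OF ab(3), of i] that by (simp add: shift_def add.commute)
    qed
    then show "a = b" using ab unfolding sections_def by (metis PiE_ext)
  qed
  have onto: "shift x ` ?S = ?S" for x
    by (rule endo_inj_surj[OF fin _ inj]) (use shift_S in auto)
  have each_shift: "card {a \<in> ?S. ?good (shift x a)} = card {q \<in> ?S. ?good q}" for x
  proof -
    have "inj_on (shift x) {a \<in> ?S. ?good (shift x a)}"
      by (rule inj_on_subset[OF inj]) blast
    then have "card {a \<in> ?S. ?good (shift x a)} = card (shift x ` {a \<in> ?S. ?good (shift x a)})"
      by (rule card_image[symmetric])
    also have "shift x ` {a \<in> ?S. ?good (shift x a)} = {q \<in> shift x ` ?S. ?good q}"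
      by blast
    finally show ?thesis by (simp only: onto)
  qed
  have few: "card {x \<in> {..<m}. ?good (shift x a)} \<le> k - 1" if a: "a \<in> ?S" for a
  proof (rule ccontr)
    let ?X = "{x \<in> {..<m}. ?good (shift x a)}"
    assume "\<not> card ?X \<le> k - 1"
    then have "k \<le> card ?X" by simp
    then obtain X where X: "X \<subseteq> ?X" "card X = k" "finite X"
      by (meson obtain_subset_with_card_n)
    then obtain h where h: "bij_betw h {..<k} X"
      using ex_bij_betw_nat_finite[OF X(3)] by (auto simp: lessThan_atLeast0)
    have hX: "h i < m" "?good (shift (h i) a)" if "i < k" for i
      using h X(1) that by (auto simp: bij_betw_def)
    define W where "W i = points ?I (shift (h i) a)" for i
    have "W i \<in> clique_sets r H" if "i < k" for i
      using points_in_clique_sets_iff[OF sH, of ?I] hX(2)[OF that] \<open>2 \<le> r\<close>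
      by (simp add: W_def)
    moreover have "disjoint_family_on W {..<k}"
      unfolding disjoint_family_on_def
    proof (intro ballI impI equals0I)
      fix i j p assume ij: "i \<in> {..<k}" "j \<in> {..<k}" "i \<noteq> j" and "p \<in> W i \<inter> W j"
      then obtain l where l: "l \<in> ?I" "(a l + h i) mod n l = (a l + h j) mod n l"
        by (auto simp: W_def points_def shift_def)
      then have "h i = h j"
        using add_mod_inj[of "h i" "n l" "h j" "a l"] hX(1)[of i] hX(1)[of j] m[of l] ij by auto
      then show False using h ij by (auto simp: bij_betw_def inj_on_def)
    qed
    ultimately show False
      using free not_free_iff_disjoint_cliques[OF sH, of k r] by blast
  qed
  have "m * card {q \<in> ?S. ?good q} = (\<Sum>x\<in>{..<m}. card {a \<in> ?S. ?good (shift x a)})"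
    by (simp only: each_shift sum_constant card_lessThan of_nat_id)
  also have "\<dots> = (\<Sum>a\<in>?S. card {x \<in> {..<m}. ?good (shift x a)})"
    by (rule sum_multicount_gen[OF finite_lessThan fin]) blast
  also have "\<dots> \<le> (\<Sum>a\<in>?S. k - 1)"
    by (rule sum_mono) (rule few)
  also have "\<dots> = (k - 1) * (\<Prod>i\<in>?I. n i)"
    by (simp add: card_sections)
  finally show ?thesis .
qed

section \<open>Counting sets of parts with weights\<close>

text \<open>The transposition of \<open>b\<close> and \<open>c\<close> maps the index sets of the left sum injectively into those
  of the right sum, and it never decreases a product: it fixes the sets containing both and
  otherwise replaces the factor \<open>n b\<close> by \<open>n c\<close>.\<close>

lemma sum_prod_exchange:
  fixes n :: "'a \<Rightarrow> nat"
  assumes I: "finite I" "b \<in> I" "c \<in> I" and B: "b \<notin> B" "c \<notin> B" and bc: "n b \<le> n c"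
  shows "(\<Sum>A | A \<subseteq> I \<and> card A = s \<and> insert b B \<subseteq> A. \<Prod>i\<in>A. n i)
       \<le> (\<Sum>A | A \<subseteq> I \<and> card A = s \<and> insert c B \<subseteq> A. \<Prod>i\<in>A. n i)"
    (is "sum ?f ?S \<le> sum ?f ?T")
proof -
  let ?t = "transpose b c"
  have inj: "inj_on ((`) ?t) ?S"
    by (rule inj_onI) (simp add: inj_image_eq_iff)
  have T: "?t ` A \<in> ?T" if "A \<in> ?S" for A
  proof -
    have A: "A \<subseteq> I" "card A = s" "b \<in> A" "B \<subseteq> A" using that by auto
    have "?t ` A \<subseteq> I" using A(1) I by (auto simp: transpose_def)
    moreover have "card (?t ` A) = s"
      using A(2) by (simp add: card_image)
    moreover have "c \<in> ?t ` A" using A(3) by (metis image_eqI transpose_apply_first)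
    moreover have "B \<subseteq> ?t ` A"
    proof
      fix x assume "x \<in> B"
      then have "?t x = x" "x \<in> A" using B A by (auto simp: transpose_def)
      then show "x \<in> ?t ` A" by (metis image_eqI)
    qed
    ultimately show ?thesis by simp
  qed
  have le: "?f A \<le> ?f (?t ` A)" if "A \<in> ?S" for A
  proof (cases "c \<in> A")
    case True
    then have "?t ` A = A" using that by (simp add: transpose_image_eq)
    then show ?thesis by simp
  next
    case False
    have b: "b \<in> A" and fin: "finite A" using that I by (auto intro: finite_subset)
    have "?f (?t ` A) = (\<Prod>i\<in>A. n (?t i))" by (simp add: prod.reindex)
    also have "\<dots> = n c * (\<Prod>i\<in>A - {b}. n (?t i))"
      by (subst prod.remove[OF fin b]) simp
    also have "(\<Prod>i\<in>A - {b}. n (?t i)) = (\<Prod>i\<in>A - {b}. n i)"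
      using False by (intro prod.cong) (auto simp: transpose_def)
    finally have "?f (?t ` A) = n c * (\<Prod>i\<in>A - {b}. n i)" .
    moreover have "?f A = n b * (\<Prod>i\<in>A - {b}. n i)"
      by (rule prod.remove[OF fin b])
    ultimately show ?thesis using bc by simp
  qed
  have "sum ?f ?S \<le> (\<Sum>A\<in>?S. ?f (?t ` A))" by (rule sum_mono) (rule le)
  also have "\<dots> = sum ?f ((`) ?t ` ?S)" by (simp only: sum.reindex[OF inj] comp_def)
  also have "\<dots> \<le> sum ?f ?T"
  proof (rule sum_mono2)
    show "finite ?T" by (rule finite_subset[of _ "Pow I"]) (use I in auto)
    show "(`) ?t ` ?S \<subseteq> ?T" using T by blast
  qed simp
  finally show ?thesis .
qed

text \<open>For \<open>i < j\<close>, exchange \<open>2\<close> for \<open>j\<close> and then \<open>1\<close> for \<open>i\<close>. In the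
  other order the first exchange is impossible when \<open>i = 2\<close>, as \<open>2\<close> is then already
  in the pair.\<close>

lemma sum_prod_pair_minimal:
  fixes n :: "nat \<Rightarrow> nat"
  assumes "n 1 \<le> n 2" and rest: "\<And>i. i \<in> {3..r} \<Longrightarrow> n 2 \<le> n i"
    and "i \<in> {1..r}" "j \<in> {1..r}" "i \<noteq> j"
  shows "(\<Sum>A | A \<subseteq> {1..r} \<and> card A = s \<and> {1, 2} \<subseteq> A. \<Prod>l\<in>A. n l)
       \<le> (\<Sum>A | A \<subseteq> {1..r} \<and> card A = s \<and> {i, j} \<subseteq> A. \<Prod>l\<in>A. n l)"
proof -
  let ?\<Sigma> = "\<lambda>B. \<Sum>A | A \<subseteq> {1..r} \<and> card A = s \<and> B \<subseteq> A. \<Prod>l\<in>A. n l"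
  have two: "n 2 \<le> n l" if "l \<in> {2..r}" for l
    using rest[of l] that by (cases "l = 2") auto
  then have one: "n 1 \<le> n l" if "l \<in> {1..r}" for l
    using assms(1) that by (cases "l = 1") (auto intro: order_trans)
  have ordered: "?\<Sigma> {1, 2} \<le> ?\<Sigma> {i, j}" if ij: "i \<in> {1..r}" "j \<in> {1..r}" "i < j" for i j
  proof -
    have "?\<Sigma> (insert 2 {1}) \<le> ?\<Sigma> (insert j {1})"
      using ij two by (intro sum_prod_exchange) auto
    also have "\<dots> = ?\<Sigma> (insert 1 {j})" by (simp add: insert_commute)
    also have "\<dots> \<le> ?\<Sigma> (insert i {j})"
      using ij one by (intro sum_prod_exchange) auto
    finally show ?thesis by (simp add: insert_commute)
  qed
  show ?thesis
    using ordered[of i j] ordered[of j i] assms(3-5) by (cases "i < j") (auto simp: insert_commute)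
qed

lemma sum_over_sets_with_pair:
  fixes f :: "nat set \<Rightarrow> nat"
  assumes "2 \<le> s" "s \<le> r"
  shows "(\<Sum>A | A \<subseteq> {1..r} \<and> card A = s \<and> {1, 2} \<subseteq> A. f (A - {1, 2})) =
         (\<Sum>B | B \<subseteq> {3..r} \<and> card B = s - 2. f B)"
proof (rule sum.reindex_bij_witness[of _ "\<lambda>B. {1, 2} \<union> B" "\<lambda>A. A - {1, 2}"])
  fix A :: "nat set" assume A: "A \<in> {A. A \<subseteq> {1..r} \<and> card A = s \<and> {1, 2} \<subseteq> A}"
  then show "{1, 2} \<union> (A - {1, 2}) = A" by auto
  have "A - {1, 2} \<subseteq> {3..r}"
  proof
    fix x assume "x \<in> A - {1, 2}"
    then have "x \<in> {1..r}" "x \<noteq> 1" "x \<noteq> 2" using A by auto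
    then show "x \<in> {3..r}" by auto
  qed
  moreover have "card (A - {1, 2}) = s - 2" using A by (subst card_Diff_subset) auto
  ultimately show "A - {1, 2} \<in> {B. B \<subseteq> {3..r} \<and> card B = s - 2}" by simp
next
  fix B :: "nat set" assume B: "B \<in> {B. B \<subseteq> {3..r} \<and> card B = s - 2}"
  then have "finite B" "1 \<notin> B" "2 \<notin> B" by (auto intro: finite_subset)
  then show "{1, 2} \<union> B - {1, 2} = B" by auto
  show "{1, 2} \<union> B \<in> {A. A \<subseteq> {1..r} \<and> card A = s \<and> {1, 2} \<subseteq> A}"
    using \<open>finite B\<close> \<open>1 \<notin> B\<close> \<open>2 \<notin> B\<close> B assms by auto
qed simp

lemma sum_prod_with_first_two:
  fixes n :: "nat \<Rightarrow> nat"
  assumes "2 \<le> s" "s \<le> r"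
  shows "(\<Sum>A | A \<subseteq> {1..r} \<and> card A = s \<and> {1, 2} \<subseteq> A. \<Prod>i\<in>A. n i) =
         (\<Sum>B | B \<subseteq> {3..r} \<and> card B = s - 2. n 1 * n 2 * (\<Prod>i\<in>B. n i))"
proof -
  have "(\<Prod>i\<in>A. n i) = n 1 * n 2 * (\<Prod>i\<in>A - {1, 2}. n i)"
    if "A \<in> {A. A \<subseteq> {1..r} \<and> card A = s \<and> {1, 2} \<subseteq> A}" for A
  proof -
    have "finite A" "{1, 2} \<subseteq> A" using that by (auto intro: finite_subset)
    then show ?thesis by (subst prod.subset_diff[of "{1, 2}"]) (auto simp: mult_ac)
  qed
  then show ?thesis
    by (simp only: sum_over_sets_with_pair[OF assms, symmetric] cong: sum.cong)
qed

section \<open>The upper bound\<close>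

text \<open>Each choice over \<open>A\<close> extends in \<open>\<Prod>i\<in>I - A. n i\<close> ways to a choice over \<open>I\<close>.\<close>

lemma card_sections_restrict:
  assumes A: "A \<subseteq> I" and I: "finite I"
  shows "card {f \<in> sections I n. Q (restrict f A)} =
         card {q \<in> sections A n. Q q} * (\<Prod>i\<in>I - A. n i)"
proof -
  let ?join = "\<lambda>(q, g) i. if i \<in> A then q i else g i"
  have "bij_betw (\<lambda>f. (restrict f A, restrict f (I - A)))
    {f \<in> sections I n. Q (restrict f A)} ({q \<in> sections A n. Q q} \<times> sections (I - A) n)"
  proof (rule bij_betw_byWitness[where f' = ?join])
    show "\<forall>f\<in>{f \<in> sections I n. Q (restrict f A)}. ?join (restrict f A, restrict f (I - A)) = f"
      using A by (fastforce simp: sections_def restrict_def PiE_def extensional_def)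
    have restr: "restrict (?join (q, g)) A = q" if "q \<in> sections A n" for q g
      using that by (fastforce simp: sections_def restrict_def PiE_def extensional_def)
    have "restrict (?join (q, g)) (I - A) = g" if "g \<in> sections (I - A) n" for q g
      using that by (fastforce simp: sections_def restrict_def PiE_def extensional_def)
    then show "\<forall>p\<in>{q \<in> sections A n. Q q} \<times> sections (I - A) n.
            (restrict (?join p) A, restrict (?join p) (I - A)) = p"
      using restr by auto
    show "(\<lambda>f. (restrict f A, restrict f (I - A))) ` {f \<in> sections I n. Q (restrict f A)}
            \<subseteq> {q \<in> sections A n. Q q} \<times> sections (I - A) n"
      using A by (fastforce simp: sections_def)
    show "?join ` ({q \<in> sections A n. Q q} \<times> sections (I - A) n)
            \<subseteq> {f \<in> sections I n. Q (restrict f A)}"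
    proof (rule image_subsetI)
      fix p assume "p \<in> {q \<in> sections A n. Q q} \<times> sections (I - A) n"
      then obtain q g where p: "p = (q, g)"
        and qg: "q \<in> sections A n" "Q q" "g \<in> sections (I - A) n" by auto
      have "?join (q, g) \<in> sections I n"
        using qg A by (fastforce simp: sections_def PiE_def extensional_def Pi_def)
      then show "?join p \<in> {f \<in> sections I n. Q (restrict f A)}"
        using restr[OF qg(1)] qg(2) by (simp add: p)
    qed
  qed
  then have "card {f \<in> sections I n. Q (restrict f A)} =
      card ({q \<in> sections A n. Q q} \<times> sections (I - A) n)"
    by (rule bij_betw_same_card)
  then show ?thesis
    using I by (simp add: card_cartesian_product card_sections)
qed

text \<open>Bad transversals and missing cliques are compared by weighted double counting: \<open>c\<close> is a lower
  bound for the total weight of the index sets over which one bad transversal fails to be a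
  clique, and \<open>miss A\<close> is the number of missing cliques over \<open>A\<close>.\<close>

lemma clique_sets_upper_bound:
  fixes n :: "nat \<Rightarrow> nat"
  assumes H: "subgraph H (complete_multipartite r n)"
    and free: "graph_free (disjoint_copies k (complete_graph r)) H"
    and s: "2 \<le> s" "s \<le> r"
    and n: "1 \<le> n 1" "n 1 \<le> n 2" "\<And>i. i \<in> {3..r} \<Longrightarrow> n 2 \<le> n i"
    and k: "1 \<le> k" "k \<le> n 1"
  shows "card (clique_sets s H) \<le>
         (\<Sum>A | A \<subseteq> {1..r} \<and> card A = s \<and> \<not> {1, 2} \<subseteq> A. \<Prod>i\<in>A. n i) +
         (\<Sum>A | A \<subseteq> {3..r} \<and> card A = s - 2. (k - 1) * n 2 * (\<Prod>i\<in>A. n i))"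
proof -
  let ?I = "{1..r}"
  let ?S = "sections ?I n"
  let ?\<A> = "{A. A \<subseteq> ?I \<and> card A = s}"
  let ?P = "\<lambda>A. \<Prod>i\<in>A. n i"
  define e where "e = (\<Sum>A | A \<subseteq> {3..r} \<and> card A = s - 2. n 2 * ?P A)"
  define c where "c = (\<Sum>A | A \<subseteq> ?I \<and> card A = s \<and> {1, 2} \<subseteq> A. ?P A)"
  define miss where "miss A = card {q \<in> sections A n. \<not> joined H A q}" for A
  define bad where "bad = {f \<in> ?S. \<not> joined H ?I f}"
  have c: "c = n 1 * e"
    unfolding c_def e_def sum_prod_with_first_two[OF s] by (simp add: sum_distrib_left mult_ac)
  have ge: "n 1 \<le> n i" if i: "i \<in> ?I" for i
  proof -
    consider "i = 1" | "i = 2" | "i \<in> {3..r}" using i by force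
    then show ?thesis using n(2) n(3)[of i] by cases auto
  qed
  have P_pos: "0 < ?P ?I"
    using ge n(1) by (intro prod_pos) (fastforce simp: Suc_le_eq)
  have finI: "finite A" if "A \<in> ?\<A>" for A using that by (auto intro: finite_subset)
  have fin\<A>: "finite ?\<A>" by (rule finite_subset[of _ "Pow ?I"]) auto
  have finS: "finite ?S" by (simp add: finite_sections)
  have complement: "card {q \<in> sections A n. joined H A q} + miss A = ?P A" if "A \<in> ?\<A>" for A
  proof -
    have "card {q \<in> sections A n. joined H A q} + miss A =
        card ({q \<in> sections A n. joined H A q} \<union> {q \<in> sections A n. \<not> joined H A q})"
      unfolding miss_def
      by (rule card_Un_disjoint[symmetric]) (use finite_sections[OF finI[OF that]] in auto)
    also have "\<dots> = card (sections A n)" by (rule arg_cong[of _ _ card]) auto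
    finally show ?thesis by (simp add: card_sections[OF finI[OF that]])
  qed
  have many_bad: "(n 1 - (k - 1)) * ?P ?I \<le> n 1 * card bad"
  proof -
    let ?good = "{f \<in> ?S. joined H ?I f}"
    have "card ?good + card bad = card (?good \<union> bad)"
      unfolding bad_def by (rule card_Un_disjoint[symmetric]) (use finS in auto)
    also have "?good \<union> bad = ?S" by (auto simp: bad_def)
    also have "card ?S = ?P ?I" by (simp add: card_sections)
    finally have "n 1 * ?P ?I = n 1 * card ?good + n 1 * card bad"
      by (metis distrib_left)
    moreover have "n 1 * card ?good \<le> (k - 1) * ?P ?I"
      using card_joined_transversals_le[OF H free _ ge] s by simp
    ultimately show ?thesis by (simp add: diff_mult_distrib)
  qed
  \<comment> \<open>The weight \<open>?P A\<close> makes each missing clique count equally.\<close>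
  have restricted: "?P A * card {f \<in> ?S. \<not> joined H A f} = miss A * ?P ?I" if "A \<in> ?\<A>" for A
  proof -
    have A: "A \<subseteq> ?I" using that by simp
    have "card {f \<in> ?S. \<not> joined H A f} = card {f \<in> ?S. \<not> joined H A (restrict f A)}"
      using joined_cong[of A _ _ H] by (metis (no_types, lifting) restrict_apply')
    also have "\<dots> = miss A * ?P (?I - A)"
      unfolding miss_def by (rule card_sections_restrict[OF A]) simp
    finally show ?thesis
      using prod.subset_diff[OF A, of n] by (simp add: mult_ac)
  qed
  have weight: "c \<le> (\<Sum>A\<in>?\<A>. if joined H A f then 0 else ?P A)" if f: "f \<in> bad" for f
  proof -
    obtain i j where ij: "i \<in> ?I" "j \<in> ?I" "i \<noteq> j" and no: "{(i, f i), (j, f j)} \<notin> edges H"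
      using f by (auto simp: bad_def joined_def)
    have "c \<le> (\<Sum>A | A \<subseteq> ?I \<and> card A = s \<and> {i, j} \<subseteq> A. ?P A)"
      unfolding c_def by (rule sum_prod_pair_minimal[OF n(2,3) ij])
    also have "\<dots> = (\<Sum>A | A \<subseteq> ?I \<and> card A = s \<and> {i, j} \<subseteq> A. if joined H A f then 0 else ?P A)"
      using ij no by (intro sum.cong) (auto simp: joined_def)
    also have "\<dots> \<le> (\<Sum>A\<in>?\<A>. if joined H A f then 0 else ?P A)"
      by (rule sum_mono2[OF fin\<A>]) auto
    finally show ?thesis .
  qed
  \<comment> \<open>Both sides of the final estimate carry the factor \<open>n 1 * ?P ?I\<close>, which then cancels.\<close>
  have "((n 1 - (k - 1)) * e) * (n 1 * ?P ?I) = (n 1 - (k - 1)) * ?P ?I * c"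
    by (simp add: c mult_ac)
  also have "\<dots> \<le> n 1 * card bad * c"
    by (rule mult_right_mono[OF many_bad zero_le])
  also have "\<dots> = n 1 * (\<Sum>f\<in>bad. c)" by simp
  also have "\<dots> \<le> n 1 * (\<Sum>f\<in>bad. \<Sum>A\<in>?\<A>. if joined H A f then 0 else ?P A)"
    by (intro mult_left_mono sum_mono weight zero_le)
  also have "\<dots> \<le> n 1 * (\<Sum>f\<in>?S. \<Sum>A\<in>?\<A>. if joined H A f then 0 else ?P A)"
    by (intro mult_left_mono sum_mono2[OF finS]) (auto simp: bad_def)
  also have "(\<Sum>f\<in>?S. \<Sum>A\<in>?\<A>. if joined H A f then 0 else ?P A) =
      (\<Sum>A\<in>?\<A>. \<Sum>f\<in>?S. if joined H A f then 0 else ?P A)"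
    by (rule sum.swap)
  also have "\<dots> = (\<Sum>A\<in>?\<A>. ?P A * card {f \<in> ?S. \<not> joined H A f})"
    using finS by (simp add: sum.If_cases Int_def Collect_neg_eq[symmetric] mult.commute)
  also have "\<dots> = (\<Sum>A\<in>?\<A>. miss A * ?P ?I)"
    by (rule sum.cong[OF refl]) (rule restricted)
  also have "n 1 * \<dots> = (\<Sum>A\<in>?\<A>. miss A) * (n 1 * ?P ?I)"
    by (simp add: sum_distrib_right[symmetric])
  finally have missing: "(n 1 - (k - 1)) * e \<le> (\<Sum>A\<in>?\<A>. miss A)"
    using P_pos n(1) by simp
  have "(\<Sum>A\<in>?\<A>. card {q \<in> sections A n. joined H A q}) + (\<Sum>A\<in>?\<A>. miss A) = (\<Sum>A\<in>?\<A>. ?P A)"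
    by (simp add: sum.distrib[symmetric] complement)
  also have "\<dots> = (\<Sum>A | A \<subseteq> ?I \<and> card A = s \<and> \<not> {1, 2} \<subseteq> A. ?P A) + c"
    unfolding c_def
    by (subst sum.union_disjoint[symmetric]) (auto intro!: sum.cong finite_subset[OF _ fin\<A>])
  finally have total: "card (clique_sets s H) + (\<Sum>A\<in>?\<A>. miss A) =
      (\<Sum>A | A \<subseteq> ?I \<and> card A = s \<and> \<not> {1, 2} \<subseteq> A. ?P A) + c"
    by (simp only: card_clique_sets[OF H s(1)])
  have "c = (k - 1) * e + (n 1 - (k - 1)) * e"
    using k by (simp add: c distrib_right[symmetric])
  moreover have "(\<Sum>A | A \<subseteq> {3..r} \<and> card A = s - 2. (k - 1) * n 2 * ?P A) = (k - 1) * e"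
    by (simp add: e_def sum_distrib_left mult_ac)
  ultimately show ?thesis
    using total missing by linarith
qed

section \<open>The extremal graph\<close>

definition extremal_graph :: "nat \<Rightarrow> nat \<Rightarrow> (nat \<Rightarrow> nat) \<Rightarrow> (nat \<times> nat) graph" where
  "extremal_graph k r n =
     (verts (complete_multipartite r n),
      {e \<in> edges (complete_multipartite r n). \<forall>x y. e = {(1, x), (2, y)} \<longrightarrow> x < k - 1})"

lemma subgraph_extremal_graph: "subgraph (extremal_graph k r n) (complete_multipartite r n)"
  using simple_complete_multipartite[of r n]
  by (auto simp: subgraph_def extremal_graph_def simple_graph_def)

lemma joined_extremal_graph:
  assumes A: "A \<subseteq> {1..r}" and q: "q \<in> sections A n"
  shows "joined (extremal_graph k r n) A q \<longleftrightarrow> ({1, 2} \<subseteq> A \<longrightarrow> q 1 < k - 1)"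
proof
  assume j: "joined (extremal_graph k r n) A q"
  show "{1, 2} \<subseteq> A \<longrightarrow> q 1 < k - 1"
  proof
    assume "{1, 2} \<subseteq> A"
    then have "{(1, q 1), (2, q 2)} \<in> edges (extremal_graph k r n)"
      using j unfolding joined_def by (simp del: One_nat_def)
    then show "q 1 < k - 1"
      unfolding extremal_graph_def snd_conv by blast
  qed
next
  assume k: "{1, 2} \<subseteq> A \<longrightarrow> q 1 < k - 1"
  show "joined (extremal_graph k r n) A q"
    unfolding joined_def extremal_graph_def snd_conv mem_Collect_eq
  proof (intro ballI impI conjI allI)
    fix i j assume ij: "i \<in> A" "j \<in> A" "i \<noteq> j"
    then show "{(i, q i), (j, q j)} \<in> edges (complete_multipartite r n)"
      using A q by (fastforce simp: edges_complete_multipartite sections_def)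
    show "x < k - 1" if "{(i, q i), (j, q j)} = {(1, x), (2, y)}" for x y
      using that ij k by (auto simp: doubleton_eq_iff)
  qed
qed

text \<open>Each of \<open>k\<close> disjoint \<open>r\<close>-cliques would need its own vertex among the first \<open>k - 1\<close> vertices
  of the first class.\<close>

lemma extremal_graph_free:
  assumes "2 \<le> r" "1 \<le> k"
  shows "graph_free (disjoint_copies k (complete_graph r)) (extremal_graph k r n)"
proof (rule ccontr)
  let ?G = "extremal_graph k r n"
  have sG: "simple_graph ?G" using subgraph_extremal_graph by (auto simp: subgraph_def)
  assume "\<not> ?thesis"
  then obtain W where W: "\<And>i. i < k \<Longrightarrow> W i \<in> clique_sets r ?G"
    and dis: "disjoint_family_on W {..<k}"
    unfolding not_free_iff_disjoint_cliques[OF sG] by blast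
  have "\<exists>x. x < k - 1 \<and> (1, x) \<in> W i" if i: "i < k" for i
  proof -
    obtain A q where A: "A \<subseteq> {1..r}" "card A = r" and q: "q \<in> sections A n" "W i = points A q"
      using clique_is_points[OF subgraph_extremal_graph W[OF i]] .
    have "A = {1..r}" using A by (intro card_subset_eq) auto
    then have 12: "{1, 2} \<subseteq> A" using \<open>2 \<le> r\<close> by auto
    have "joined ?G A q"
      using points_in_clique_sets_iff[OF sG, of A q] W[OF i] A q \<open>2 \<le> r\<close> by simp
    then show ?thesis
      using 12 joined_extremal_graph[OF A(1) q(1)] q(2) by (auto simp: points_def)
  qed
  then obtain h where h: "\<And>i. i < k \<Longrightarrow> h i < k - 1 \<and> (1, h i) \<in> W i" by metis
  have "inj_on h {..<k}"
  proof (rule inj_onI, rule ccontr)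
    fix i j assume "i \<in> {..<k}" "j \<in> {..<k}" "h i = h j" "i \<noteq> j"
    then have "(1, h i) \<in> W i \<inter> W j" using h[of i] h[of j] by auto
    then show False
      using dis \<open>i \<in> _\<close> \<open>j \<in> _\<close> \<open>i \<noteq> j\<close> by (auto simp: disjoint_family_on_def)
  qed
  then have "card {..<k} \<le> card {..<k - 1}"
    by (rule card_inj_on_le) (use h in auto)
  then show False using \<open>1 \<le> k\<close> by simp
qed

text \<open>Over index sets containing both \<open>1\<close> and \<open>2\<close>, the cliques are all choices from classes whose
  first one has been shrunk to size \<open>k - 1\<close>; so they are counted by the same formula with
  \<open>n 1\<close> replaced by \<open>k - 1\<close>.\<close>

lemma card_clique_sets_extremal_graph:
  assumes s: "2 \<le> s" "s \<le> r" and k: "k \<le> n 1"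
  shows "card (clique_sets s (extremal_graph k r n)) =
         (\<Sum>A | A \<subseteq> {1..r} \<and> card A = s \<and> \<not> {1, 2} \<subseteq> A. \<Prod>i\<in>A. n i) +
         (\<Sum>A | A \<subseteq> {3..r} \<and> card A = s - 2. (k - 1) * n 2 * (\<Prod>i\<in>A. n i))"
proof -
  let ?G = "extremal_graph k r n"
  let ?\<A> = "{A. A \<subseteq> {1..r} \<and> card A = s}"
  let ?J = "\<lambda>A. card {q \<in> sections A n. joined ?G A q}"
  define n' where "n' = n(1 := k - 1)"
  have fin\<A>: "finite ?\<A>" by (rule finite_subset[of _ "Pow {1..r}"]) auto
  have finA: "finite A" if "A \<subseteq> {1..r}" for A using that by (auto intro: finite_subset)
  have without: "?J A = (\<Prod>i\<in>A. n i)" if "A \<subseteq> {1..r}" "\<not> {1, 2} \<subseteq> A" for A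
  proof -
    have "{q \<in> sections A n. joined ?G A q} = sections A n"
      using joined_extremal_graph[OF that(1)] that(2) by blast
    then show ?thesis by (simp add: card_sections[OF finA[OF that(1)]])
  qed
  have with_pair: "?J A = (\<Prod>i\<in>A. n' i)" if "A \<subseteq> {1..r}" "{1, 2} \<subseteq> A" for A
  proof -
    have "{q \<in> sections A n. joined ?G A q} = {q \<in> sections A n. q 1 < k - 1}"
      using joined_extremal_graph[OF that(1)] that(2) by blast
    also have "\<dots> = sections A n'"
      using that(2) k by (fastforce simp: sections_def n'_def PiE_def Pi_def split: if_splits)
    finally show ?thesis by (simp add: card_sections[OF finA[OF that(1)]])
  qed
  have "card (clique_sets s ?G) = (\<Sum>A\<in>?\<A>. ?J A)"
    by (rule card_clique_sets[OF subgraph_extremal_graph s(1)])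
  also have "\<dots> = (\<Sum>A | A \<subseteq> {1..r} \<and> card A = s \<and> \<not> {1, 2} \<subseteq> A. ?J A) +
      (\<Sum>A | A \<subseteq> {1..r} \<and> card A = s \<and> {1, 2} \<subseteq> A. ?J A)"
    by (subst sum.union_disjoint[symmetric]) (auto intro!: sum.cong finite_subset[OF _ fin\<A>])
  also have "(\<Sum>A | A \<subseteq> {1..r} \<and> card A = s \<and> \<not> {1, 2} \<subseteq> A. ?J A) =
      (\<Sum>A | A \<subseteq> {1..r} \<and> card A = s \<and> \<not> {1, 2} \<subseteq> A. \<Prod>i\<in>A. n i)"
    by (rule sum.cong[OF refl]) (use without in blast)
  also have "(\<Sum>A | A \<subseteq> {1..r} \<and> card A = s \<and> {1, 2} \<subseteq> A. ?J A) =
      (\<Sum>A | A \<subseteq> {1..r} \<and> card A = s \<and> {1, 2} \<subseteq> A. \<Prod>i\<in>A. n' i)"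
    by (rule sum.cong[OF refl]) (use with_pair in blast)
  also have "\<dots> = (\<Sum>A | A \<subseteq> {3..r} \<and> card A = s - 2. (k - 1) * n 2 * (\<Prod>i\<in>A. n i))"
    unfolding sum_prod_with_first_two[OF s]
  proof (rule sum.cong[OF refl])
    fix A assume "A \<in> {A. A \<subseteq> {3..r} \<and> card A = s - 2}"
    then have "(\<Prod>i\<in>A. n' i) = (\<Prod>i\<in>A. n i)"
      by (intro prod.cong) (auto simp: n'_def)
    then show "n' 1 * n' 2 * (\<Prod>i\<in>A. n' i) = (k - 1) * n 2 * (\<Prod>i\<in>A. n i)"
      by (simp add: n'_def)
  qed
  finally show ?thesis .
qed

theorem theorem1p5:
  fixes s r k :: nat and n :: "nat \<Rightarrow> nat"
  assumes "2 \<le> s" and "s \<le> r"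
    and "1 \<le> n 1" and "n 1 \<le> n 2" and "n 2 \<le> n 3"
    and "1 \<le> k" and "k \<le> n 1"
    and "\<And>i. 4 \<le> i \<Longrightarrow> i \<le> r \<Longrightarrow> n i = n 3"
  shows "ex_copies (complete_multipartite r n) (complete_graph s)
           (disjoint_copies k (complete_graph r)) =
         (\<Sum>A | A \<subseteq> {1..r} \<and> card A = s \<and> \<not> {1, 2} \<subseteq> A. \<Prod>i\<in>A. n i) +
         (\<Sum>A | A \<subseteq> {3..r} \<and> card A = s - 2. (k - 1) * n 2 * (\<Prod>i\<in>A. n i))"
    (is "_ = ?N")
proof -
  let ?G = "complete_multipartite r n"
  let ?X = "{card (copies (complete_graph s) H) | H.
    subgraph H ?G \<and> graph_free (disjoint_copies k (complete_graph r)) H}"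
  have rest: "n 2 \<le> n i" if "i \<in> {3..r}" for i
    using assms(5) assms(8)[of i] that by (cases "i = 3") auto
  have le: "x \<le> ?N" if X: "x \<in> ?X" for x
  proof -
    obtain H where x: "x = card (copies (complete_graph s) H)" and H: "subgraph H ?G"
      and free: "graph_free (disjoint_copies k (complete_graph r)) H"
      using X by blast
    have "x = card (clique_sets s H)"
      using x H card_copies_complete_graph[of H s] by (simp add: subgraph_def)
    then show ?thesis
      using clique_sets_upper_bound[OF H free assms(1-4) rest assms(6,7)] by simp
  qed
  have "?N = card (copies (complete_graph s) (extremal_graph k r n))"
    using card_copies_complete_graph[of "extremal_graph k r n" s] subgraph_extremal_graph[of k r n]
      card_clique_sets_extremal_graph[where n = n, OF assms(1,2,7)] by (simp add: subgraph_def)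
  moreover have "graph_free (disjoint_copies k (complete_graph r)) (extremal_graph k r n)"
    using assms by (intro extremal_graph_free) auto
  ultimately have "?N \<in> ?X"
    using subgraph_extremal_graph[of k r n] by blast
  moreover have "finite ?X"
    by (rule finite_subset[of _ "{..?N}"]) (use le in auto)
  ultimately show ?thesis
    unfolding ex_copies_def using le by (intro Max_eqI) auto
qed

end
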